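(* Proportional Approval Voting ($\mathit{PAV}$) satisfies EJR: for every ballot profile $\vec{A}=(A_1,\dots,A_n)$ over a candidate set $C$ and every $k$ with $1\le k\le|C|$, every committee that can be output by $\mathit{PAV}$ on $(\vec{A},k)$ (irrespective of tie-breaking) provides extended justified representation for $(\vec{A},k)$.
   Context: Setting. $N=\{1,\dots,n\}$ ($n\ge 1$) is a set of voters, $C$ is a finite set of candidates. Each voter $i\in N$ submits an approval ballot $A_i\subseteq C$; the list $\vec{A}=(A_1,\dots,A_n)$ is the ballot profile. An approval-based multi-winner rule takes $(N,C,\vec{A},k)$ with $1\le k\le|C|$ and returns a committee $W\subseteq C$ with $|W|=k$. Extended justified representation (EJR). For a positive integer $\ell\le k$, a set $W\subseteq C$ with $|W|=k$ provides $\ell$-justified representation ($\ell$-JR) for $(\vec{A},k)$ if there is no set of voters $N^*\subseteq N$ with $|N^*|\ge\ell\cdot\frac nk$ such that $|\bigcap_{i\in N^*}A_i|\ge\ell$ but $|A_i\cap W|<\ell$ for each $i\in N^*$. $W$ provides EJR for $(\vec{A},k)$ if it provides $\ell$-JR for all $\ell$ with $1\le\ell\le k$. $\mathit{PAV}$: the $\mathit{PAV}$-score of $W\subseteq C$ is $\sum_{i\in N}r(|W\cap A_i|)$, where $r(p)=\sum_{j=1}^p\frac1j$; $\mathit{PAV}$ outputs a set $W\subseteq C$ of size $k$ with the highest $\mathit{PAV}$-score. *)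

theory Defs
  imports "HOL-Analysis.Harmonic_Numbers"
begin

text \<open>
  The voters are \<open>{1..n}\<close>, the candidates form a finite set \<open>C :: 'c set\<close>, and a ballot
  profile is a function \<open>A :: nat \<Rightarrow> 'c set\<close> of which only the values on \<open>{1..n}\<close> matter.
\<close>

definition committee :: "'c set \<Rightarrow> nat \<Rightarrow> 'c set \<Rightarrow> bool" where
  "committee C k W \<longleftrightarrow> W \<subseteq> C \<and> card W = k"

text \<open>
  For positive \<open>l\<close> and \<open>k\<close> the size bound forces \<open>Ns \<noteq> {}\<close> (as \<open>n \<ge> 1\<close>), so the
  intersection below is never the intersection of an empty family.
\<close>

definition provides_JR :: "nat \<Rightarrow> 'c set \<Rightarrow> (nat \<Rightarrow> 'c set) \<Rightarrow> nat \<Rightarrow> nat \<Rightarrow> 'c set \<Rightarrow> bool" where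
  "provides_JR n C A k l W \<longleftrightarrow>
     committee C k W \<and>
     \<not> (\<exists>Ns \<subseteq> {1..n}.
          real (card Ns) \<ge> real l * (real n / real k) \<and>
          card (\<Inter>i\<in>Ns. A i) \<ge> l \<and>
          (\<forall>i\<in>Ns. card (A i \<inter> W) < l))"

definition provides_EJR :: "nat \<Rightarrow> 'c set \<Rightarrow> (nat \<Rightarrow> 'c set) \<Rightarrow> nat \<Rightarrow> 'c set \<Rightarrow> bool" where
  "provides_EJR n C A k W \<longleftrightarrow> (\<forall>l\<in>{1..k}. provides_JR n C A k l W)"

text \<open>\<open>harm p\<close> is the harmonic number \<open>1 + 1/2 + ... + 1/p\<close>, with \<open>harm 0 = 0\<close>.\<close>

definition PAV_score :: "nat \<Rightarrow> (nat \<Rightarrow> 'c set) \<Rightarrow> 'c set \<Rightarrow> real" where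
  "PAV_score n A W = (\<Sum>i\<in>{1..n}. harm (card (W \<inter> A i)))"

text \<open>All committees tied for the highest score, i.e. the possible outputs over all
  tie-breaking rules.\<close>

definition PAV :: "nat \<Rightarrow> 'c set \<Rightarrow> (nat \<Rightarrow> 'c set) \<Rightarrow> nat \<Rightarrow> 'c set set" where
  "PAV n C A k = {W. is_arg_max (PAV_score n A) (committee C k) W}"

end

theory Submission
  imports Defs
begin

text \<open>
  Suppose a group of at least \<open>l * n / k\<close> voters witnesses a failure of \<open>l\<close>-JR. They share a
  candidate \<open>c\<close> outside \<open>W\<close>, and adding \<open>c\<close> raises the score of each of them by at least
  \<open>1 / l\<close>, hence the total by at least \<open>n / k\<close>. By optimality of \<open>W\<close>, removing any member of
  \<open>insert c W\<close> costs at least as much. But the costs of the \<open>k + 1\<close> members sum to at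
  most \<open>n\<close>, since a voter who approves \<open>m\<close> of them contributes \<open>1 / m\<close> for each of
  these \<open>m\<close>.
\<close>

text \<open>Only voters approving \<open>w\<close> are affected: their count drops from some
  \<open>m\<close> to \<open>m - 1\<close>, so the harmonic number loses its last term
  \<open>1 / m\<close>.\<close>

lemma PAV_score_remove:
  assumes "finite W" "w \<in> W"
  shows "PAV_score n A W - PAV_score n A (W - {w}) =
    (\<Sum>i\<in>{1..n}. if w \<in> A i then 1 / real (card (W \<inter> A i)) else 0)"
proof -
  have "harm (card (W \<inter> A i)) - harm (card ((W - {w}) \<inter> A i)) =
      (if w \<in> A i then 1 / real (card (W \<inter> A i)) else 0)" for i
  proof (cases "w \<in> A i")
    case True
    then have "W \<inter> A i = insert w ((W - {w}) \<inter> A i)"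
      using assms by auto
    then have "card (W \<inter> A i) = Suc (card ((W - {w}) \<inter> A i))"
      using assms by (metis DiffD2 IntD1 card_insert_disjoint finite_Diff finite_Int singletonI)
    then show ?thesis
      using True by (simp add: harm_Suc inverse_eq_divide)
  next
    case False
    then have "(W - {w}) \<inter> A i = W \<inter> A i"
      by auto
    then show ?thesis
      using False by simp
  qed
  then show ?thesis
    by (simp add: PAV_score_def flip: sum_subtractf)
qed

lemma sum_PAV_score_remove_le:
  assumes "finite W"
  shows "(\<Sum>w\<in>W. PAV_score n A W - PAV_score n A (W - {w})) \<le> real n"
proof -
  have "(\<Sum>w\<in>W. PAV_score n A W - PAV_score n A (W - {w})) =
      (\<Sum>i\<in>{1..n}. \<Sum>w\<in>W. if w \<in> A i then 1 / real (card (W \<inter> A i)) else 0)"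
    by (simp add: PAV_score_remove assms sum.swap[of _ W])
  also have "\<dots> = (\<Sum>i\<in>{1..n}. real (card (W \<inter> A i)) * (1 / real (card (W \<inter> A i))))"
    using assms by (simp flip: sum.inter_restrict)
  \<comment> \<open>Each summand is 1, except that it is 0 for a voter who approves nobody in
    \<open>W\<close>.\<close>
  also have "\<dots> \<le> (\<Sum>i\<in>{1..n}. 1)"
    by (intro sum_mono) auto
  finally show ?thesis
    by simp
qed

text \<open>The gain from adding \<open>c\<close> is the cost of removing it from
  \<open>insert c W\<close>. A voter in \<open>Ns\<close> approves at most \<open>l\<close> members
  of that larger set and so contributes at least \<open>1 / l\<close>; all other voters contribute
  nonnegative amounts.\<close>

lemma PAV_score_insert_ge:
  assumes "finite W" "c \<notin> W" "Ns \<subseteq> {1..n}"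
    and "\<And>i. i \<in> Ns \<Longrightarrow> c \<in> A i"
    and "\<And>i. i \<in> Ns \<Longrightarrow> card (W \<inter> A i) < l"
  shows "real (card Ns) / real l \<le> PAV_score n A (insert c W) - PAV_score n A W"
proof -
  have "real (card Ns) / real l = (\<Sum>i\<in>Ns. 1 / real l)"
    by simp
  also have "\<dots> \<le> (\<Sum>i\<in>Ns. if c \<in> A i then 1 / real (card (insert c W \<inter> A i)) else 0)"
  proof (rule sum_mono)
    fix i assume i: "i \<in> Ns"
    have "card (insert c W \<inter> A i) = Suc (card (W \<inter> A i))"
      using assms i by simp
    then show "1 / real l \<le> (if c \<in> A i then 1 / real (card (insert c W \<inter> A i)) else 0)"
      using assms(4,5)[OF i] by (simp add: divide_simps)
  qed
  also have "\<dots> \<le> (\<Sum>i\<in>{1..n}. if c \<in> A i then 1 / real (card (insert c W \<inter> A i)) else 0)"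
    using assms(3) by (intro sum_mono2) auto
  also have "\<dots> = PAV_score n A (insert c W) - PAV_score n A W"
    using PAV_score_remove[of "insert c W" c n A] assms(1,2) by simp
  finally show ?thesis .
qed

theorem theorem10:
  fixes n k :: nat and C :: "'c set" and A :: "nat \<Rightarrow> 'c set" and W :: "'c set"
  assumes "n \<ge> 1"
    and "finite C"
    and "\<And>i. i \<in> {1..n} \<Longrightarrow> A i \<subseteq> C"
    and "1 \<le> k" and "k \<le> card C"
    and "W \<in> PAV n C A k"
  shows "provides_EJR n C A k W"
proof -
  have W: "W \<subseteq> C" "card W = k"
    and opt: "\<And>V. committee C k V \<Longrightarrow> PAV_score n A V \<le> PAV_score n A W"
    using assms(6) by (auto simp: PAV_def is_arg_max_linorder committee_def)
  have fin: "finite W"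
    using W(1) assms(2) by (rule finite_subset)
  have False
    if l: "l \<in> {1..k}" and Ns: "Ns \<subseteq> {1..n}" and size: "real (card Ns) \<ge> real l * (real n / real k)"
      and cohesive: "card (\<Inter>i\<in>Ns. A i) \<ge> l" and under: "\<And>i. i \<in> Ns \<Longrightarrow> card (A i \<inter> W) < l"
    for l Ns
  proof -
    have "real l * (real n / real k) > 0"
      using l assms(1,4) by simp
    then obtain j where j: "j \<in> Ns"
      using size by fastforce
    \<comment> \<open>Otherwise the at least \<open>l\<close> shared candidates would all lie in
      \<open>A j \<inter> W\<close>, which has fewer than \<open>l\<close> elements.\<close>
    have "\<not> (\<Inter>i\<in>Ns. A i) \<subseteq> W"
    proof
      assume "(\<Inter>i\<in>Ns. A i) \<subseteq> W"
      then have "card (\<Inter>i\<in>Ns. A i) \<le> card (A j \<inter> W)"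
        using j fin by (intro card_mono) auto
      then show False
        using cohesive under[OF j] by simp
    qed
    then obtain c where c: "\<And>i. i \<in> Ns \<Longrightarrow> c \<in> A i" "c \<notin> W"
      by auto
    have "c \<in> C"
      using c(1)[OF j] assms(3) j Ns by blast
    let ?V = "insert c W"
    have "real n / real k \<le> real (card Ns) / real l"
      using size l by (simp add: field_simps)
    also have "\<dots> \<le> PAV_score n A ?V - PAV_score n A W"
      using fin c Ns under by (intro PAV_score_insert_ge) (auto simp: Int_commute)
    finally have gain: "real n / real k \<le> PAV_score n A ?V - PAV_score n A W" .
    \<comment> \<open>\<open>?V - {w}\<close> has size \<open>k\<close> again, so it scores at most
      as much as \<open>W\<close>; for \<open>w = c\<close> it is \<open>W\<close> itself.\<close>
    have loss: "real n / real k \<le> PAV_score n A ?V - PAV_score n A (?V - {w})" if "w \<in> ?V" for w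
    proof -
      have "committee C k (?V - {w})"
        using that \<open>c \<in> C\<close> W fin c(2) by (auto simp: committee_def card_Diff_singleton)
      from opt[OF this] gain show ?thesis
        by simp
    qed
    \<comment> \<open>The contradiction comes from the extra member: \<open>k + 1\<close> losses of
      at least \<open>n / k\<close> add up to at least \<open>n + n / k > n\<close>.\<close>
    have "real (Suc k) * (real n / real k) = real (card ?V) * (real n / real k)"
      using fin c(2) W(2) by simp
    also have "\<dots> \<le> (\<Sum>w\<in>?V. PAV_score n A ?V - PAV_score n A (?V - {w}))"
      by (intro sum_bounded_below loss)
    also have "\<dots> \<le> real n"
      using fin by (intro sum_PAV_score_remove_le) simp
    finally show False
      using assms(1,4) by (simp add: field_simps)
  qed
  then show ?thesis
    unfolding provides_EJR_def provides_JR_def committee_def using W by blast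
qed

end
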